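(* Let $(G,D,\star)$ be a probabilistic metric space such that the triangle function $\star$ is continuous (resp. $k$-Lipschitz for some real $k>0$). Let $\omega_\star$ be a modulus of uniform continuity of $\star$ on $\Delta^+$. For $x,y\in G$ put $\sigma_D(x,y):=\sup_{z\in G} d_{\mathcal L}(D(x,z),D(y,z))$. Then the metric $\sigma_D$ on $G$ satisfies, for all $x,y\in G$, $$d_{\mathcal L}(D(x,y),\mathcal H_0)\le \sigma_D(x,y)\le \omega_\star\big(d_{\mathcal L}(D(x,y),\mathcal H_0)\big)$$ (resp. $d_{\mathcal L}(D(x,y),\mathcal H_0)\le \sigma_D(x,y)\le k\,d_{\mathcal L}(D(x,y),\mathcal H_0)$). In particular, the identity map $i:(G,\tau)\to(G,\sigma_D)$ is a uniform homeomorphism, where $\tau$ is the topology on $G$ induced by the strong neighborhood system $\{N_x(t):x\in G,\ t>0\}$.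
   Context: $\Delta^+$ is the set of all nondecreasing functions $F:[-\infty,+\infty]\to[0,1]$, left-continuous on $\mathbb R$, with $F(-\infty)=0$, $F(0)=0$, $F(+\infty)=1$. For $a\ge 0$, $\mathcal H_a(t)=0$ if $t\le a$ and $\mathcal H_a(t)=1$ if $t>a$. Order: $F\le L$ iff $F(t)\le L(t)$ for all $t\in\mathbb R$. Modified Lévy distance: for $F,L\in\Delta^+$ and $h>0$ let $A^h_{F,L}=\{t\ge 0: L(t)\le F(t+h)+h\}$, and $d_{\mathcal L}(F,L)=\inf\{h>0:[0,h^{-1})\subset A^h_{F,L}\cap A^h_{L,F}\}$. It is known that $d_{\mathcal L}$ is a metric on $\Delta^+$, that $(\Delta^+,d_{\mathcal L})$ is compact, and that $d_{\mathcal L}(F_n,F)\to0$ iff $F_n\to F$ weakly, i.e. $F_n(t)\to F(t)$ at every continuity point $t$ of $F$. A triangle function is a binary operation $\star$ on $\Delta^+$ that is commutative, associative, nondecreasing in each place, with neutral element $\mathcal H_0$. It is continuous if $F_n\to F$ and $L_n\to L$ weakly imply $F_n\star L_n\to F\star L$ weakly (equivalently, it is continuous for $d_{\mathcal L}$). It is $k$-Lipschitz if $d_{\mathcal L}(F\star L,F'\star L')\le k(d_{\mathcal L}(F,F')+d_{\mathcal L}(L,L'))$ for all $F,L,F',L'\in\Delta^+$. A modulus of uniform continuity of $\star$ is a function $\omega_\star:[0,+\infty]\to[0,+\infty]$ with $\lim_{t\to0}\omega_\star(t)=\omega_\star(0)=0$ and $d_{\mathcal L}(F\star L,F'\star L')\le\omega_\star(d_{\mathcal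 L}(F,F')+d_{\mathcal L}(L,L'))$ for all $F,L,F',L'\in\Delta^+$. A probabilistic metric space $(G,D,\star)$ is a set $G$ with a triangle function $\star$ and a map $D:G\times G\to\Delta^+$ such that $D(x,y)=\mathcal H_0$ iff $x=y$; $D(x,y)=D(y,x)$; and $D(x,y)\star D(y,z)\le D(x,z)$ for all $x,y,z\in G$. Strong neighborhoods: $N_x(t)=\{y\in G: D(x,y)(t)>1-t\}$ for $t>0$; it is known that $y\in N_x(t)$ iff $d_{\mathcal L}(D(x,y),\mathcal H_0)<t$. The topology $\tau$ has $\{N_x(t):t>0\}$ as neighborhood base at each $x$, and the associated uniform structure on $G$ is generated by the entourages $\{(x,y): d_{\mathcal L}(D(x,y),\mathcal H_0)<t\}$, $t>0$. "Uniform homeomorphism" means that $i$ is a homeomorphism and that $i$ and $i^{-1}$ are uniformly continuous for this uniform structure and the metric $\sigma_D$. *)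

theory Defs
  imports "HOL-Analysis.Analysis"
begin

definition Delta_plus :: "(ereal \<Rightarrow> real) set" where
  "Delta_plus = {F. mono F \<and> range F \<subseteq> {0..1}
     \<and> (\<forall>t::real. continuous (at_left t) (\<lambda>s. F (ereal s)))
     \<and> F (-\<infinity>) = 0 \<and> F 0 = 0 \<and> F \<infinity> = 1}"

definition Heav :: "real \<Rightarrow> ereal \<Rightarrow> real" where
  "Heav a t = (if t \<le> ereal a then 0 else 1)"

definition df_le :: "(ereal \<Rightarrow> real) \<Rightarrow> (ereal \<Rightarrow> real) \<Rightarrow> bool" where
  "df_le F L \<longleftrightarrow> (\<forall>t::real. F (ereal t) \<le> L (ereal t))"

definition levy_set :: "real \<Rightarrow> (ereal \<Rightarrow> real) \<Rightarrow> (ereal \<Rightarrow> real) \<Rightarrow> real set" where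
  "levy_set h F L = {t. 0 \<le> t \<and> L (ereal t) \<le> F (ereal (t + h)) + h}"

definition levy_dist :: "(ereal \<Rightarrow> real) \<Rightarrow> (ereal \<Rightarrow> real) \<Rightarrow> real" where
  "levy_dist F L = Inf {h. 0 < h \<and> {0..<inverse h} \<subseteq> levy_set h F L \<inter> levy_set h L F}"

lemma levy_dist_bounds:
  assumes "F \<in> Delta_plus" and "L \<in> Delta_plus"
  shows "0 \<le> levy_dist F L" and "levy_dist F L \<le> 1"
proof -
  let ?S = "{h. 0 < h \<and> {0..<inverse h} \<subseteq> levy_set h F L \<inter> levy_set h L F}"
  have "0 \<le> F t" "F t \<le> 1" "0 \<le> L t" "L t \<le> 1" for t
    using assms by (auto simp: Delta_plus_def image_subset_iff)
  then have "L s \<le> F t + 1" "F s \<le> L t + 1" for s t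
    by (smt (verit))+
  then have one: "1 \<in> ?S"
    by (auto simp: levy_set_def)
  then show "0 \<le> levy_dist F L"
    unfolding levy_dist_def by (intro cInf_greatest) (blast, simp)
  have "bdd_below ?S"
    by (intro bdd_belowI[of _ 0]) auto
  with one show "levy_dist F L \<le> 1"
    unfolding levy_dist_def by (rule cInf_lower)
qed

text \<open>At \<open>-\<infinity>\<close> and \<open>\<infinity>\<close> all elements of \<open>Delta_plus\<close> agree, so only real continuity
  points matter.\<close>

definition weak_conv :: "(nat \<Rightarrow> ereal \<Rightarrow> real) \<Rightarrow> (ereal \<Rightarrow> real) \<Rightarrow> bool" where
  "weak_conv Fn F \<longleftrightarrow>
     (\<forall>t::real. isCont (\<lambda>s. F (ereal s)) t \<longrightarrow> (\<lambda>n. Fn n (ereal t)) \<longlonglongrightarrow> F (ereal t))"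

locale triangle_function =
  fixes star :: "(ereal \<Rightarrow> real) \<Rightarrow> (ereal \<Rightarrow> real) \<Rightarrow> (ereal \<Rightarrow> real)"
  assumes closed: "\<And>F L. F \<in> Delta_plus \<Longrightarrow> L \<in> Delta_plus \<Longrightarrow> star F L \<in> Delta_plus"
    and commute: "\<And>F L. F \<in> Delta_plus \<Longrightarrow> L \<in> Delta_plus \<Longrightarrow> star F L = star L F"
    and assoc: "\<And>F L K. F \<in> Delta_plus \<Longrightarrow> L \<in> Delta_plus \<Longrightarrow> K \<in> Delta_plus \<Longrightarrow>
                  star (star F L) K = star F (star L K)"
    and mono_left: "\<And>F F' L. F \<in> Delta_plus \<Longrightarrow> F' \<in> Delta_plus \<Longrightarrow> L \<in> Delta_plus \<Longrightarrow>
                  df_le F F' \<Longrightarrow> df_le (star F L) (star F' L)"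
    and mono_right: "\<And>F L L'. F \<in> Delta_plus \<Longrightarrow> L \<in> Delta_plus \<Longrightarrow> L' \<in> Delta_plus \<Longrightarrow>
                  df_le L L' \<Longrightarrow> df_le (star F L) (star F L')"
    and neutral_left: "\<And>F. F \<in> Delta_plus \<Longrightarrow> star (Heav 0) F = F"
    and neutral_right: "\<And>F. F \<in> Delta_plus \<Longrightarrow> star F (Heav 0) = F"

definition continuous_tf ::
  "((ereal \<Rightarrow> real) \<Rightarrow> (ereal \<Rightarrow> real) \<Rightarrow> (ereal \<Rightarrow> real)) \<Rightarrow> bool" where
  "continuous_tf star \<longleftrightarrow>
     (\<forall>Fn Ln F L. range Fn \<subseteq> Delta_plus \<longrightarrow> range Ln \<subseteq> Delta_plus \<longrightarrow>
        F \<in> Delta_plus \<longrightarrow> L \<in> Delta_plus \<longrightarrow> weak_conv Fn F \<longrightarrow> weak_conv Ln L \<longrightarrow>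
        weak_conv (\<lambda>n. star (Fn n) (Ln n)) (star F L))"

definition lipschitz_tf ::
  "real \<Rightarrow> ((ereal \<Rightarrow> real) \<Rightarrow> (ereal \<Rightarrow> real) \<Rightarrow> (ereal \<Rightarrow> real)) \<Rightarrow> bool" where
  "lipschitz_tf k star \<longleftrightarrow>
     (\<forall>F\<in>Delta_plus. \<forall>L\<in>Delta_plus. \<forall>F'\<in>Delta_plus. \<forall>L'\<in>Delta_plus.
        levy_dist (star F L) (star F' L') \<le> k * (levy_dist F F' + levy_dist L L'))"

definition modulus_tf ::
  "(ennreal \<Rightarrow> ennreal) \<Rightarrow> ((ereal \<Rightarrow> real) \<Rightarrow> (ereal \<Rightarrow> real) \<Rightarrow> (ereal \<Rightarrow> real)) \<Rightarrow> bool" where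
  "modulus_tf \<omega> star \<longleftrightarrow>
     \<omega> 0 = 0 \<and> (\<omega> \<longlongrightarrow> 0) (at 0) \<and>
     (\<forall>F\<in>Delta_plus. \<forall>L\<in>Delta_plus. \<forall>F'\<in>Delta_plus. \<forall>L'\<in>Delta_plus.
        ennreal (levy_dist (star F L) (star F' L'))
          \<le> \<omega> (ennreal (levy_dist F F' + levy_dist L L')))"

locale prob_metric_space = triangle_function star
  for G :: "'a set" and D :: "'a \<Rightarrow> 'a \<Rightarrow> ereal \<Rightarrow> real" and star +
  assumes D_in: "\<And>x y. x \<in> G \<Longrightarrow> y \<in> G \<Longrightarrow> D x y \<in> Delta_plus"
    and D_eq_Heav: "\<And>x y. x \<in> G \<Longrightarrow> y \<in> G \<Longrightarrow> D x y = Heav 0 \<longleftrightarrow> x = y"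
    and D_sym: "\<And>x y. x \<in> G \<Longrightarrow> y \<in> G \<Longrightarrow> D x y = D y x"
    and D_triangle: "\<And>x y z. x \<in> G \<Longrightarrow> y \<in> G \<Longrightarrow> z \<in> G \<Longrightarrow>
                       df_le (star (D x y) (D y z)) (D x z)"

text \<open>The value 0 off \<open>G\<close> is a convention: the locale \<open>Metric_space\<close> asks for nonnegativity and
  symmetry on the whole type. On \<open>G\<close> the supremum is over a nonempty set which is bounded
  by 1, see \<open>levy_dist_bounds\<close>.\<close>

definition sigma_dist :: "'a set \<Rightarrow> ('a \<Rightarrow> 'a \<Rightarrow> ereal \<Rightarrow> real) \<Rightarrow> 'a \<Rightarrow> 'a \<Rightarrow> real" where
  "sigma_dist G D x y =
     (if x \<in> G \<and> y \<in> G then SUP z\<in>G. levy_dist (D x z) (D y z) else 0)"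

definition strong_nhd :: "'a set \<Rightarrow> ('a \<Rightarrow> 'a \<Rightarrow> ereal \<Rightarrow> real) \<Rightarrow> 'a \<Rightarrow> real \<Rightarrow> 'a set" where
  "strong_nhd G D x t = {y \<in> G. D x y (ereal t) > 1 - t}"

definition strong_topology :: "'a set \<Rightarrow> ('a \<Rightarrow> 'a \<Rightarrow> ereal \<Rightarrow> real) \<Rightarrow> 'a topology" where
  "strong_topology G D =
     topology (\<lambda>U. U \<subseteq> G \<and> (\<forall>x\<in>U. \<exists>t>0. strong_nhd G D x t \<subseteq> U))"

lemma (in prob_metric_space) openin_strong_topology:
  "openin (strong_topology G D) U \<longleftrightarrow> U \<subseteq> G \<and> (\<forall>x\<in>U. \<exists>t>0. strong_nhd G D x t \<subseteq> U)"
proof -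
  have mono: "strong_nhd G D x s \<subseteq> strong_nhd G D x t" if "x \<in> G" "s \<le> t" for x s t
  proof
    fix y assume y: "y \<in> strong_nhd G D x s"
    then have "y \<in> G" "1 - s < D x y (ereal s)"
      by (auto simp: strong_nhd_def)
    moreover have "D x y (ereal s) \<le> D x y (ereal t)"
      using D_in[OF \<open>x \<in> G\<close> \<open>y \<in> G\<close>] \<open>s \<le> t\<close> by (auto simp: Delta_plus_def mono_def)
    ultimately show "y \<in> strong_nhd G D x t"
      using \<open>s \<le> t\<close> by (auto simp: strong_nhd_def)
  qed
  let ?open = "\<lambda>U. U \<subseteq> G \<and> (\<forall>x\<in>U. \<exists>t>0. strong_nhd G D x t \<subseteq> U)"
  have "?open (S \<inter> T)" if ST: "?open S" "?open T" for S T
  proof (intro conjI ballI)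
    show "S \<inter> T \<subseteq> G"
      using ST by blast
    fix x assume x: "x \<in> S \<inter> T"
    then obtain s t where "s > 0" "strong_nhd G D x s \<subseteq> S" "t > 0" "strong_nhd G D x t \<subseteq> T"
      using ST by blast
    moreover have "x \<in> G"
      using x ST by blast
    ultimately show "\<exists>t>0. strong_nhd G D x t \<subseteq> S \<inter> T"
      using mono[of x "min s t" s] mono[of x "min s t" t]
      by (intro exI[of _ "min s t"]) auto
  qed
  moreover have "?open (\<Union>\<K>)" if op: "\<forall>K\<in>\<K>. ?open K" for \<K>
  proof (intro conjI ballI)
    show "\<Union>\<K> \<subseteq> G"
      using op by blast
    fix x assume "x \<in> \<Union>\<K>"
    then obtain K where "K \<in> \<K>" "x \<in> K"
      by blast
    with op obtain t where "t > 0" "strong_nhd G D x t \<subseteq> K"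
      by blast
    with \<open>K \<in> \<K>\<close> show "\<exists>t>0. strong_nhd G D x t \<subseteq> \<Union>\<K>"
      by blast
  qed
  ultimately have "istopology ?open"
    unfolding istopology_def by presburger
  then show ?thesis
    unfolding strong_topology_def by simp
qed

text \<open>Uniform structures on a carrier are given as filters on pairs, as in the class
  \<open>uniform_space\<close>; uniform continuity is the filter limit used for \<open>uniformly_continuous_on\<close>.\<close>

definition strong_uniformity :: "'a set \<Rightarrow> ('a \<Rightarrow> 'a \<Rightarrow> ereal \<Rightarrow> real) \<Rightarrow> ('a \<times> 'a) filter" where
  "strong_uniformity G D =
     (INF t\<in>{0<..}. principal {(x, y). x \<in> G \<and> y \<in> G \<and> levy_dist (D x y) (Heav 0) < t})"

definition metric_uniformity :: "'a set \<Rightarrow> ('a \<Rightarrow> 'a \<Rightarrow> real) \<Rightarrow> ('a \<times> 'a) filter" where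
  "metric_uniformity M d = (INF e\<in>{0<..}. principal {(x, y). x \<in> M \<and> y \<in> M \<and> d x y < e})"

definition uniformly_cont ::
  "('a \<times> 'a) filter \<Rightarrow> ('b \<times> 'b) filter \<Rightarrow> ('a \<Rightarrow> 'b) \<Rightarrow> bool" where
  "uniformly_cont U V f \<longleftrightarrow> filterlim (\<lambda>(x, y). (f x, f y)) V U"

definition uniform_homeomorphism_maps ::
  "'a topology \<Rightarrow> ('a \<times> 'a) filter \<Rightarrow> 'b topology \<Rightarrow> ('b \<times> 'b) filter
     \<Rightarrow> ('a \<Rightarrow> 'b) \<Rightarrow> ('b \<Rightarrow> 'a) \<Rightarrow> bool" where
  "uniform_homeomorphism_maps X U Y V f g \<longleftrightarrow>
     homeomorphic_maps X Y f g \<and> uniformly_cont U V f \<and> uniformly_cont V U g"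

end

theory Submission
  imports "HOL-Probability.Helly_Selection" Defs
begin

text \<open>Since \<open>D x y \<star> D y z \<le> D x z\<close> and \<open>D y x \<star> D x z \<le> D y z\<close>, the distance between \<open>D x z\<close> and
  \<open>D y z\<close> is at most the larger of the distances from \<open>D x y \<star> L\<close> to \<open>L = H\<^sub>0 \<star> L\<close> for
  \<open>L = D y z, D x z\<close>, and a modulus or a Lipschitz constant of \<open>\<star>\<close> bounds it. The lower bound is the case
  \<open>z = y\<close> of the supremum. For the uniform structures one needs that \<open>F \<star> L\<close> is close to \<open>L\<close>
  uniformly in \<open>L\<close> when \<open>F\<close> is close to \<open>H\<^sub>0\<close>; by Helly's selection theorem a sequence of
  counterexamples would have a weakly convergent subsequence.\<close>

section \<open>The modified Levy distance\<close>

text \<open>The numbers \<open>h\<close> over which \<open>levy_dist\<close> takes its infimum, with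
  both inclusions unfolded. On \<open>Delta_plus\<close> they form an up-closed set, so estimates
  are made on single \<open>h\<close> rather than on the infimum.\<close>

definition levy_valid :: "real \<Rightarrow> (ereal \<Rightarrow> real) \<Rightarrow> (ereal \<Rightarrow> real) \<Rightarrow> bool" where
  "levy_valid h F L \<longleftrightarrow> 0 < h \<and> (\<forall>t::real. 0 \<le> t \<longrightarrow> t < inverse h \<longrightarrow>
     L (ereal t) \<le> F (ereal (t + h)) + h \<and> F (ereal t) \<le> L (ereal (t + h)) + h)"

lemma levy_dist_eq_Inf_valid: "levy_dist F L = Inf {h. levy_valid h F L}"
proof -
  have "{h. 0 < h \<and> {0..<inverse h} \<subseteq> levy_set h F L \<inter> levy_set h L F} = {h. levy_valid h F L}"
    by (auto simp: levy_valid_def levy_set_def subset_iff)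
  then show ?thesis
    by (simp add: levy_dist_def)
qed

lemma levy_dist_le: "levy_valid h F L \<Longrightarrow> levy_dist F L \<le> h"
  unfolding levy_dist_eq_Inf_valid
  by (intro cInf_lower bdd_belowI[of _ 0]) (auto simp: levy_valid_def)

lemma levy_valid_sym: "levy_valid h F L \<longleftrightarrow> levy_valid h L F"
  by (auto simp: levy_valid_def)

lemma levy_dist_sym: "levy_dist F L = levy_dist L F"
  unfolding levy_dist_eq_Inf_valid by (simp only: levy_valid_sym[of _ F L])

lemma Delta_plus_mono: "F \<in> Delta_plus \<Longrightarrow> s \<le> t \<Longrightarrow> F s \<le> F t"
  by (auto simp: Delta_plus_def mono_def)

lemma Delta_plus_nonneg: "F \<in> Delta_plus \<Longrightarrow> 0 \<le> F t"
  and Delta_plus_le_1: "F \<in> Delta_plus \<Longrightarrow> F t \<le> 1"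
  by (simp_all add: Delta_plus_def image_subset_iff)

lemma Delta_plus_nonpos_eq_0:
  assumes "F \<in> Delta_plus" "t \<le> 0"
  shows "F t = 0"
proof -
  have "F 0 = 0"
    using assms(1) by (simp add: Delta_plus_def)
  then show ?thesis
    using Delta_plus_mono[OF assms] Delta_plus_nonneg[OF assms(1), of t] by simp
qed

lemma Delta_plus_left_continuous:
  "F \<in> Delta_plus \<Longrightarrow> ((\<lambda>s. F (ereal s)) \<longlongrightarrow> F (ereal t)) (at_left t)"
  by (simp add: Delta_plus_def continuous_within)

text \<open>Values lie in \<open>[0,1]\<close>, so a slack of 1 makes both inequalities trivial. The
  infimum is therefore over a nonempty set, and later arguments may assume
  \<open>h < 1\<close>.\<close>

lemma levy_valid_ge_1:
  assumes "F \<in> Delta_plus" "L \<in> Delta_plus" "1 \<le> h"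
  shows "levy_valid h F L"
  unfolding levy_valid_def
  using assms Delta_plus_nonneg[OF assms(1)] Delta_plus_nonneg[OF assms(2)]
    Delta_plus_le_1[OF assms(1)] Delta_plus_le_1[OF assms(2)]
  by (smt (verit, best))

text \<open>Enlarging \<open>h\<close> shortens the range of \<open>t\<close> and raises both the
  shifted values and the slack.\<close>

lemma levy_valid_mono:
  assumes "F \<in> Delta_plus" "L \<in> Delta_plus" "levy_valid h F L" "h \<le> h'"
  shows "levy_valid h' F L"
  unfolding levy_valid_def
proof (intro conjI allI impI)
  have h: "0 < h"
    using assms by (simp add: levy_valid_def)
  then show "0 < h'"
    using assms by simp
  fix t :: real
  assume t: "0 \<le> t" "t < inverse h'"
  moreover have "inverse h' \<le> inverse h"
    using h assms by (simp add: le_imp_inverse_le)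
  ultimately have "L (ereal t) \<le> F (ereal (t + h)) + h \<and> F (ereal t) \<le> L (ereal (t + h)) + h"
    using assms(3) by (auto simp: levy_valid_def)
  moreover have "F (ereal (t + h)) \<le> F (ereal (t + h'))" "L (ereal (t + h)) \<le> L (ereal (t + h'))"
    using assms by (auto intro!: Delta_plus_mono)
  ultimately show "L (ereal t) \<le> F (ereal (t + h')) + h'" "F (ereal t) \<le> L (ereal (t + h')) + h'"
    using assms(4) by auto
qed

lemma levy_valid_if_levy_dist_less:
  assumes "F \<in> Delta_plus" "L \<in> Delta_plus" "levy_dist F L < h"
  shows "levy_valid h F L"
proof -
  have "{h. levy_valid h F L} \<noteq> {}"
    using levy_valid_ge_1[OF assms(1,2), of 1] by auto
  then obtain h' where "levy_valid h' F L" "h' < h"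
    using cInf_lessD[of "{h. levy_valid h F L}" h] assms(3) by (auto simp: levy_dist_eq_Inf_valid)
  then show ?thesis
    using levy_valid_mono[OF assms(1,2)] by auto
qed

text \<open>Shifts and slacks add up on the way through \<open>L\<close>. The point to check is that
  \<open>t + a\<close> and \<open>t + b\<close> stay in the range where the second comparison
  applies.\<close>

lemma levy_valid_add:
  assumes F: "F \<in> Delta_plus" and K: "K \<in> Delta_plus"
    and FL: "levy_valid a F L" and LK: "levy_valid b L K"
  shows "levy_valid (a + b) F K"
proof (cases "1 \<le> a + b")
  case True
  then show ?thesis
    using levy_valid_ge_1 F K by blast
next
  case False
  have pos: "0 < a" "0 < b"
    using FL LK by (auto simp: levy_valid_def)
  \<comment> \<open>Multiplied by \<open>a * (a + b)\<close>, the claim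
    \<open>inverse (a + b) + b \<le> inverse a\<close> reduces to
    \<open>b * (a * (a + b)) \<le> b\<close>, which holds since \<open>a + b < 1\<close>; likewise
    with \<open>a\<close> and \<open>b\<close> exchanged.\<close>
  have "a * (a + b) \<le> 1" "b * (a + b) \<le> 1"
    using False pos mult_mono[of a 1 "a + b" 1] mult_mono[of b 1 "a + b" 1] by auto
  then have "b * (a * (a + b)) \<le> b" "a * (b * (a + b)) \<le> a"
    using pos mult_left_mono[of "a * (a + b)" 1 b] mult_left_mono[of "b * (a + b)" 1 a] by auto
  then have ab: "inverse (a + b) + b \<le> inverse a" "inverse (a + b) + a \<le> inverse b"
    using pos by (simp_all add: field_simps)
  show ?thesis
    unfolding levy_valid_def
  proof (intro conjI allI impI)
    show "0 < a + b"
      using pos by simp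
    fix t :: real
    assume t: "0 \<le> t" "t < inverse (a + b)"
    then have "t < inverse a" "t < inverse b" "t + b < inverse a" "t + a < inverse b"
      using ab pos by linarith+
    then have "K (ereal t) \<le> L (ereal (t + b)) + b" "L (ereal (t + b)) \<le> F (ereal (t + b + a)) + a"
      "F (ereal t) \<le> L (ereal (t + a)) + a" "L (ereal (t + a)) \<le> K (ereal (t + a + b)) + b"
      using FL LK t pos by (auto simp: levy_valid_def)
    then show "K (ereal t) \<le> F (ereal (t + (a + b))) + (a + b)"
      "F (ereal t) \<le> K (ereal (t + (a + b))) + (a + b)"
      by (simp_all add: algebra_simps)
  qed
qed

lemma levy_dist_triangle:
  assumes F: "F \<in> Delta_plus" and L: "L \<in> Delta_plus" and K: "K \<in> Delta_plus"
  shows "levy_dist F K \<le> levy_dist F L + levy_dist L K"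
proof (rule field_le_epsilon)
  fix e :: real
  assume "0 < e"
  then have "levy_valid (levy_dist F L + e / 2) F L" "levy_valid (levy_dist L K + e / 2) L K"
    using assms by (auto intro!: levy_valid_if_levy_dist_less)
  from levy_dist_le[OF levy_valid_add[OF F K this]]
  show "levy_dist F K \<le> levy_dist F L + levy_dist L K + e"
    by (simp add: algebra_simps)
qed

lemma levy_dist_self: "F \<in> Delta_plus \<Longrightarrow> levy_dist F F = 0"
proof -
  assume F: "F \<in> Delta_plus"
  have "levy_valid h F F" if "0 < h" for h
    using that Delta_plus_mono[OF F] by (fastforce simp: levy_valid_def intro: add_increasing2)
  then have "levy_dist F F \<le> 0 + h" if "0 < h" for h
    using that levy_dist_le by auto
  then have "levy_dist F F \<le> 0"
    by (rule field_le_epsilon)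
  then show ?thesis
    using levy_dist_bounds(1)[OF F F] by simp
qed

section \<open>Distance to the neutral element\<close>

lemma Heav_0_in_Delta_plus: "Heav 0 \<in> Delta_plus"
proof -
  have "((\<lambda>s. Heav 0 (ereal s)) \<longlongrightarrow> Heav 0 (ereal t)) (at_left t)" for t :: real
  proof (rule tendsto_eventually)
    show "eventually (\<lambda>s. Heav 0 (ereal s) = Heav 0 (ereal t)) (at_left t)"
    proof (cases "t \<le> 0")
      case True
      then show ?thesis
        by (auto simp: eventually_at_left_field Heav_def zero_ereal_def intro!: exI[of _ "t - 1"])
    next
      case False
      then show ?thesis
        by (auto simp: eventually_at_left_field Heav_def zero_ereal_def intro!: exI[of _ 0])
    qed
  qed
  then show ?thesis
    by (auto simp: Delta_plus_def continuous_within Heav_def mono_def zero_ereal_def)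
qed

text \<open>This links \<open>strong_nhd\<close> to \<open>levy_dist\<close>. One Levy inequality is
  immediate, since \<open>Heav 0\<close> is 1 at \<open>u + h > 0\<close>; the other compares
  \<open>1 - h\<close> with \<open>F\<close> just to the right of \<open>h\<close>.\<close>

lemma levy_dist_Heav_less_iff:
  assumes F: "F \<in> Delta_plus" and t: "0 < t"
  shows "levy_dist F (Heav 0) < t \<longleftrightarrow> 1 - t < F (ereal t)"
proof
  assume less: "levy_dist F (Heav 0) < t"
  define h where "h = (levy_dist F (Heav 0) + t) / 2"
  have h: "levy_dist F (Heav 0) < h" "h < t"
    using less by (auto simp: h_def)
  then have val: "levy_valid h F (Heav 0)"
    using F Heav_0_in_Delta_plus levy_valid_if_levy_dist_less by blast
  then have pos: "0 < h"
    by (simp add: levy_valid_def)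
  \<comment> \<open>\<open>Heav 0\<close> vanishes at 0, so validity is used at a positive point. As
    \<open>h\<close> is halfway between the distance and \<open>t\<close>, there is room for
    \<open>s > 0\<close> with \<open>s + h \<le> t\<close>.\<close>
  define s where "s = min (t - h) (inverse h / 2)"
  have s: "0 < s" "s < inverse h" "s + h \<le> t"
    using h pos by (auto simp: s_def min_less_iff_disj)
  then have "1 \<le> F (ereal (s + h)) + h"
    using val by (auto simp: levy_valid_def Heav_def dest!: spec[of _ s])
  also have "F (ereal (s + h)) \<le> F (ereal t)"
    using s by (auto intro!: Delta_plus_mono F)
  finally show "1 - t < F (ereal t)"
    using h by simp
next
  assume less: "1 - t < F (ereal t)"
  \<comment> \<open>Left continuity moves the strict inequality from \<open>t\<close> to some
    \<open>h < t\<close>, which makes the distance strictly smaller than \<open>t\<close>.\<close>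
  have "((\<lambda>s. F (ereal s) + s) \<longlongrightarrow> F (ereal t) + t) (at_left t)"
    by (intro tendsto_intros Delta_plus_left_continuous F)
  then have "eventually (\<lambda>s. 1 < F (ereal s) + s) (at_left t)"
    using less by (intro order_tendstoD) auto
  moreover have "eventually (\<lambda>s. 0 < s \<and> s < t) (at_left t)"
    using t by (auto simp: eventually_at_left_field)
  ultimately obtain h where h: "1 < F (ereal h) + h" "0 < h" "h < t"
    using eventually_happens'[OF trivial_limit_at_left_real[of t] eventually_conj] by blast
  have "levy_valid h F (Heav 0)"
    unfolding levy_valid_def
  proof (intro conjI allI impI)
    fix u :: real
    assume u: "0 \<le> u"
    have "F (ereal h) \<le> F (ereal (u + h))"
      using u by (auto intro!: Delta_plus_mono F)
    then show "Heav 0 (ereal u) \<le> F (ereal (u + h)) + h"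
      using h by (auto simp: Heav_def)
    show "F (ereal u) \<le> Heav 0 (ereal (u + h)) + h"
      using u h Delta_plus_le_1[OF F, of "ereal u"] by (auto simp: Heav_def zero_ereal_def)
  qed (use h in auto)
  then show "levy_dist F (Heav 0) < t"
    using levy_dist_le h by fastforce
qed

lemma levy_dist_Heav_eq_0_imp:
  assumes F: "F \<in> Delta_plus" and "levy_dist F (Heav 0) = 0"
  shows "F = Heav 0"
proof
  have one: "F (ereal t) = 1" if "0 < t" for t
  proof (rule antisym)
    show "1 \<le> F (ereal t)"
    proof (rule field_le_epsilon)
      fix e :: real
      assume e: "0 < e"
      \<comment> \<open>The radius \<open>min e t\<close> keeps the point of evaluation at most
        \<open>t\<close> and the error at most \<open>e\<close>.\<close>
      have "1 - min e t < F (ereal (min e t))"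
        using levy_dist_Heav_less_iff[OF F, of "min e t"] assms e that by simp
      also have "\<dots> \<le> F (ereal t)"
        by (intro Delta_plus_mono F) simp
      finally show "1 \<le> F (ereal t) + e"
        by simp
    qed
  qed (rule Delta_plus_le_1[OF F])
  have "F \<infinity> = 1"
    using F by (simp add: Delta_plus_def)
  fix t
  show "F t = Heav 0 t"
    using one \<open>F \<infinity> = 1\<close> Delta_plus_nonpos_eq_0[OF F, of t]
    by (cases t) (auto simp: Heav_def zero_ereal_def)
qed

section \<open>Weak convergence\<close>

text \<open>The only jump of \<open>Heav 0\<close> is at 0. At \<open>t < 0\<close> all functions
  vanish, and at \<open>t > 0\<close> the values exceed \<open>1 - e\<close> as soon as the distance
  is below \<open>e \<le> t\<close>.\<close>

lemma weak_conv_Heav_0: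
  assumes Fn: "\<And>n. Fn n \<in> Delta_plus" and lim: "(\<lambda>n. levy_dist (Fn n) (Heav 0)) \<longlonglongrightarrow> 0"
  shows "weak_conv Fn (Heav 0)"
  unfolding weak_conv_def
proof (intro allI impI)
  fix t :: real
  assume cont: "isCont (\<lambda>s. Heav 0 (ereal s)) t"
  have "t \<noteq> 0"
  proof
    assume "t = 0"
    then have "((\<lambda>s. Heav 0 (ereal s)) \<longlongrightarrow> 0) (at_right 0)"
      using cont by (auto simp: isCont_def Heav_def zero_ereal_def intro: filterlim_mono at_le)
    moreover have "((\<lambda>s. Heav 0 (ereal s)) \<longlongrightarrow> 1) (at_right (0::real))"
      by (intro tendsto_eventually)
        (auto simp: eventually_at_right_field Heav_def zero_ereal_def intro!: exI[of _ 1])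
    ultimately show False
      using tendsto_unique[OF trivial_limit_at_right_real] by fastforce
  qed
  show "(\<lambda>n. Fn n (ereal t)) \<longlonglongrightarrow> Heav 0 (ereal t)"
  proof (cases "t < 0")
    case True
    then show ?thesis
      using Delta_plus_nonpos_eq_0[OF Fn, of "ereal t"] by (simp add: Heav_def zero_ereal_def)
  next
    case False
    with \<open>t \<noteq> 0\<close> have t: "0 < t"
      by simp
    have "(\<lambda>n. Fn n (ereal t)) \<longlonglongrightarrow> 1"
    proof (rule LIMSEQ_I)
      fix r :: real
      assume "0 < r"
      define e where "e = min r t"
      have e: "0 < e" "e \<le> r" "e \<le> t"
        using t \<open>0 < r\<close> by (auto simp: e_def)
      obtain N where N: "\<And>n. n \<ge> N \<Longrightarrow> levy_dist (Fn n) (Heav 0) < e"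
        using order_tendstoD(2)[OF lim e(1)] by (auto simp: eventually_sequentially)
      show "\<exists>N. \<forall>n\<ge>N. norm (Fn n (ereal t) - 1) < r"
      proof (intro exI allI impI)
        fix n
        assume "n \<ge> N"
        then have "1 - e < Fn n (ereal e)"
          using N levy_dist_Heav_less_iff[OF Fn e(1)] by blast
        moreover have "Fn n (ereal e) \<le> Fn n (ereal t)"
          using e by (auto intro!: Delta_plus_mono Fn)
        ultimately show "norm (Fn n (ereal t) - 1) < r"
          using e Delta_plus_le_1[OF Fn, of n "ereal t"] by simp
      qed
    qed
    then show ?thesis
      using t by (simp add: Heav_def zero_ereal_def)
  qed
qed

text \<open>A monotone function has countably many discontinuities, and an open interval is
  uncountable.\<close>

lemma mono_continuity_point_between:
  fixes f :: "real \<Rightarrow> real"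
  assumes "mono f" "a < b"
  obtains c where "a < c" "c < b" "isCont f c"
proof -
  have "countable {x. \<not> isCont f x}"
    using assms(1) by (rule mono_ctble_discont)
  then have "\<not> {a<..<b} \<subseteq> {x. \<not> isCont f x}"
    using assms(2) uncountable_open_interval countable_subset by blast
  then show ?thesis
    using that by auto
qed

text \<open>Convergence at finitely many continuity points suffices: they are placed so that each
  window \<open>[t, t + h]\<close> with \<open>0 \<le> t < inverse h\<close> contains one, and
  monotonicity carries the estimate to \<open>t\<close> and \<open>t + h\<close>.\<close>

lemma weak_conv_imp_levy_dist:
  assumes Fn: "\<And>n. Fn n \<in> Delta_plus" and F: "F \<in> Delta_plus" and weak: "weak_conv Fn F"
  shows "(\<lambda>n. levy_dist (Fn n) F) \<longlonglongrightarrow> 0"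
proof (rule LIMSEQ_I)
  fix r :: real
  assume "0 < r"
  define h where "h = r / 2"
  have h: "0 < h" "h < r"
    using \<open>0 < r\<close> by (auto simp: h_def)
  have "mono (\<lambda>s. F (ereal s))"
    by (auto intro!: monoI Delta_plus_mono F)
  \<comment> \<open>One continuity point is chosen inside each cell of a grid of mesh
    \<open>h / 2\<close>.\<close>
  then have "\<exists>c. real i * (h / 2) < c \<and> c < (real i + 1) * (h / 2) \<and> isCont (\<lambda>s. F (ereal s)) c" for i
    using mono_continuity_point_between[of "\<lambda>s. F (ereal s)" "real i * (h / 2)" "(real i + 1) * (h / 2)"] h
    by (auto simp: field_simps)
  then obtain c where c: "\<And>i. real i * (h / 2) < c i" "\<And>i. c i < (real i + 1) * (h / 2)"
    "\<And>i. isCont (\<lambda>s. F (ereal s)) (c i)"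
    by metis
  \<comment> \<open>This bounds every index obtained by rounding up \<open>t / (h / 2)\<close> with
    \<open>t < inverse h\<close>, so finitely many points are involved.\<close>
  define N where "N = nat \<lceil>inverse h / (h / 2)\<rceil>"
  have "eventually (\<lambda>n. \<bar>Fn n (ereal (c i)) - F (ereal (c i))\<bar> < h) sequentially" for i
    using weak c(3) h tendstoD[of "\<lambda>n. Fn n (ereal (c i))" "F (ereal (c i))" sequentially h]
    by (auto simp: weak_conv_def dist_real_def)
  then have "eventually (\<lambda>n. \<forall>i\<in>{..N}. \<bar>Fn n (ereal (c i)) - F (ereal (c i))\<bar> < h) sequentially"
    by (intro eventually_ball_finite) auto
  then obtain n0 where n0: "\<And>n i. n \<ge> n0 \<Longrightarrow> i \<le> N \<Longrightarrow> \<bar>Fn n (ereal (c i)) - F (ereal (c i))\<bar> < h"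
    by (auto simp: eventually_sequentially)
  have "levy_valid h (Fn n) F" if n: "n \<ge> n0" for n
    unfolding levy_valid_def
  proof (intro conjI allI impI)
    fix t :: real
    assume t: "0 \<le> t" "t < inverse h"
    \<comment> \<open>Rounding up gives
      \<open>t \<le> i * (h / 2) < c i < (i + 1) * (h / 2) < t + h\<close>.\<close>
    define i where "i = nat \<lceil>t / (h / 2)\<rceil>"
    have "real i = of_int \<lceil>t / (h / 2)\<rceil>"
      using t h by (simp add: i_def)
    then have "t / (h / 2) \<le> real i" "real i < t / (h / 2) + 1"
      by linarith+
    then have i: "t \<le> real i * (h / 2)" "real i * (h / 2) < t + h / 2"
      using h by (simp_all add: field_simps)
    have "t / (h / 2) \<le> inverse h / (h / 2)"
      using t h by (intro divide_right_mono) auto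
    then have "i \<le> N"
      unfolding i_def N_def by (intro nat_mono ceiling_mono)
    then have close: "\<bar>Fn n (ereal (c i)) - F (ereal (c i))\<bar> < h"
      using n0 n by blast
    have "t \<le> c i" "c i \<le> t + h"
      using c(1)[of i] c(2)[of i] i by (auto simp: algebra_simps)
    then have "F (ereal t) \<le> F (ereal (c i))" "F (ereal (c i)) \<le> F (ereal (t + h))"
      "Fn n (ereal t) \<le> Fn n (ereal (c i))" "Fn n (ereal (c i)) \<le> Fn n (ereal (t + h))"
      by (auto intro!: Delta_plus_mono F Fn)
    then show "F (ereal t) \<le> Fn n (ereal (t + h)) + h" "Fn n (ereal t) \<le> F (ereal (t + h)) + h"
      using close by auto
  qed (rule h)
  then have "levy_dist (Fn n) F < r" if "n \<ge> n0" for n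
    using that levy_dist_le h(2) by fastforce
  then show "\<exists>no. \<forall>n\<ge>no. norm (levy_dist (Fn n) F - 0) < r"
    using levy_dist_bounds(1)[OF Fn F] by (intro exI[of _ n0]) auto
qed

text \<open>The library theorem is about right-continuous functions, hence the reflection
  \<open>x \<mapsto> - F (- x)\<close>.\<close>

lemma Delta_plus_weakly_sequentially_compact:
  fixes Kn :: "nat \<Rightarrow> ereal \<Rightarrow> real"
  assumes Kn: "\<And>n. Kn n \<in> Delta_plus"
  obtains s L where "strict_mono s" "L \<in> Delta_plus" "weak_conv (Kn \<circ> s) L"
proof -
  define f where "f n x = - Kn n (ereal (- x))" for n and x :: real
  have rcont: "continuous (at_right x) (f n)" for n x
  proof -
    have "((\<lambda>y. Kn n (ereal (- y))) \<longlongrightarrow> Kn n (ereal (- x))) (at_right x)"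
      using Delta_plus_left_continuous[OF Kn, of n "- x"]
      by (simp add: at_right_minus filterlim_filtermap)
    from tendsto_minus[OF this] show ?thesis
      by (simp add: continuous_within f_def[abs_def])
  qed
  have mono: "mono (f n)" for n
    by (auto simp: f_def intro!: monoI Delta_plus_mono Kn)
  have bound: "\<bar>f n x\<bar> \<le> 1" for n x
    using Delta_plus_nonneg[OF Kn] Delta_plus_le_1[OF Kn] by (simp add: f_def)
  obtain s where s: "strict_mono s" and "\<exists>K. (\<forall>x. continuous (at_right x) K) \<and> mono K \<and>
      (\<forall>x. \<bar>K x\<bar> \<le> 1) \<and> (\<forall>x. isCont K x \<longrightarrow> (\<lambda>n. f (s n) x) \<longlonglongrightarrow> K x)"
    using Helly_selection[of f 1, OF rcont mono bound] by blast
  then obtain K where K_cont: "\<And>x. continuous (at_right x) K" and K_mono: "mono K"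
    and K_lim: "\<And>x. isCont K x \<Longrightarrow> (\<lambda>n. f (s n) x) \<longlonglongrightarrow> K x"
    by auto
  define l where "l t = - K (- t)" for t
  have l_mono: "mono l"
    using K_mono by (auto simp: l_def mono_def)
  have l_cont: "(l \<longlongrightarrow> l t) (at_left t)" for t
  proof -
    have "((\<lambda>y. K (- y)) \<longlongrightarrow> K (- t)) (at_left t)"
      using K_cont[of "- t"] by (simp add: continuous_within at_left_minus filterlim_filtermap)
    then show ?thesis
      unfolding l_def by (intro tendsto_intros)
  qed
  have l_lim: "(\<lambda>n. Kn (s n) (ereal t)) \<longlonglongrightarrow> l t" if "isCont l t" for t
  proof -
    have "isCont (\<lambda>x. - l (- x)) (- t)"
      using isCont_o2[of "- t" uminus l] that by (simp add: isCont_minus)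
    then have "isCont K (- t)"
      by (simp add: l_def)
    from tendsto_minus[OF K_lim[OF this]] show ?thesis
      by (simp add: f_def l_def)
  qed
  \<comment> \<open>Bounds pass to the limit at continuity points; any other \<open>t\<close> lies
    between two of these.\<close>
  have l_range: "0 \<le> l t" "l t \<le> 1" for t
  proof -
    have *: "0 \<le> l u \<and> l u \<le> 1" if "isCont l u" for u
      using LIMSEQ_le_const[OF l_lim[OF that], of 0] LIMSEQ_le_const2[OF l_lim[OF that], of 1]
        Delta_plus_nonneg[OF Kn] Delta_plus_le_1[OF Kn] by blast
    obtain a where "a < t" "isCont l a"
      using mono_continuity_point_between[OF l_mono, of "t - 1" t] by auto
    then show "0 \<le> l t"
      using * l_mono by (meson less_imp_le monoD order_trans)
    obtain b where "t < b" "isCont l b"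
      using mono_continuity_point_between[OF l_mono, of t "t + 1"] by auto
    then show "l t \<le> 1"
      using * l_mono by (meson less_imp_le monoD order_trans)
  qed
  have l_neg: "l t = 0" if "t < 0" for t
  proof -
    obtain c where c: "t < c" "c < 0" "isCont l c"
      using mono_continuity_point_between[OF l_mono \<open>t < 0\<close>] by blast
    have "(\<lambda>n. Kn (s n) (ereal c)) = (\<lambda>n. 0)"
      using c Delta_plus_nonpos_eq_0[OF Kn, of "ereal c"] by (auto simp: zero_ereal_def)
    then have "l c = 0"
      using l_lim[OF c(3)] LIMSEQ_unique tendsto_const by metis
    then show ?thesis
      using monoD[OF l_mono, of t c] c l_range(1)[of t] by simp
  qed
  have "(l \<longlongrightarrow> 0) (at_left 0)"
    using l_neg by (intro tendsto_eventually)
      (auto simp: eventually_at_left_field intro!: exI[of _ "-1"])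
  then have l_0: "l 0 = 0"
    using l_cont[of 0] tendsto_unique[OF trivial_limit_at_left_real] by blast
  \<comment> \<open>The values at the infinities are prescribed. Mass may escape to infinity along
    the sequence: \<open>L\<close> then jumps to 1 at \<open>\<infinity>\<close>, which
    \<open>Delta_plus\<close> permits.\<close>
  define L where "L t = (if t = \<infinity> then 1 else if t = -\<infinity> then 0 else l (real_of_ereal t))" for t
  have L_real: "L (ereal t) = l t" for t
    by (simp add: L_def)
  have L_mono: "mono L"
  proof (rule monoI)
    fix a b :: ereal
    assume "a \<le> b"
    then show "L a \<le> L b"
      using l_range monoD[OF l_mono] by (cases a; cases b) (auto simp: L_def)
  qed
  have "L \<in> Delta_plus"
    using L_mono l_cont l_0 L_real[of 0] l_range
    by (auto simp: Delta_plus_def continuous_within L_real zero_ereal_def) (auto simp: L_def)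
  moreover have "weak_conv (Kn \<circ> s) L"
    using l_lim by (auto simp: weak_conv_def L_real)
  ultimately show ?thesis
    using that s by blast
qed

section \<open>Continuity of the triangle function at the neutral element\<close>

text \<open>Compactness makes \<open>d\<close> independent of \<open>L\<close>. Along a subsequence
  of counterexamples with second arguments tending weakly to \<open>L\<close>, the products tend to
  \<open>star (Heav 0) L = L\<close> as well, so the distance between the two cannot stay above
  \<open>e\<close>.\<close>

lemma (in triangle_function) continuous_imp_levy_dist_star_small:
  assumes cont: "continuous_tf star" and e: "0 < e"
  obtains d where "0 < d" "\<And>F L. F \<in> Delta_plus \<Longrightarrow> L \<in> Delta_plus \<Longrightarrow>
    levy_dist F (Heav 0) < d \<Longrightarrow> levy_dist (star F L) L < e"
proof (rule ccontr)
  assume "\<not> thesis"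
  then have "\<exists>F L. F \<in> Delta_plus \<and> L \<in> Delta_plus \<and> levy_dist F (Heav 0) < inverse (real (Suc n))
      \<and> e \<le> levy_dist (star F L) L" for n
    using that[of "inverse (real (Suc n))"] by (force simp: not_less)
  then obtain Fn Kn where Fn: "\<And>n. Fn n \<in> Delta_plus" and Kn: "\<And>n. Kn n \<in> Delta_plus"
    and small: "\<And>n. levy_dist (Fn n) (Heav 0) < inverse (real (Suc n))"
    and large: "\<And>n. e \<le> levy_dist (star (Fn n) (Kn n)) (Kn n)"
    by metis
  obtain s L where s: "strict_mono s" and L: "L \<in> Delta_plus" and weak: "weak_conv (Kn \<circ> s) L"
    by (rule Delta_plus_weakly_sequentially_compact[OF Kn])
  have "(\<lambda>n. levy_dist (Fn n) (Heav 0)) \<longlonglongrightarrow> 0"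
    using levy_dist_bounds(1)[OF Fn Heav_0_in_Delta_plus] small
    by (intro tendsto_sandwich[OF _ _ tendsto_const LIMSEQ_inverse_real_of_nat] always_eventually)
      (auto intro: less_imp_le)
  then have "(\<lambda>n. levy_dist ((Fn \<circ> s) n) (Heav 0)) \<longlonglongrightarrow> 0"
    using LIMSEQ_subseq_LIMSEQ[OF _ s] by (fastforce simp: comp_def)
  then have "weak_conv (Fn \<circ> s) (Heav 0)"
    using Fn by (intro weak_conv_Heav_0) auto
  then have "weak_conv (\<lambda>n. star ((Fn \<circ> s) n) ((Kn \<circ> s) n)) (star (Heav 0) L)"
    using cont[unfolded continuous_tf_def, rule_format, of "Fn \<circ> s" "Kn \<circ> s" "Heav 0" L]
      weak Fn Kn L Heav_0_in_Delta_plus by (simp add: image_subset_iff)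
  then have "(\<lambda>n. levy_dist (star ((Fn \<circ> s) n) ((Kn \<circ> s) n)) L) \<longlonglongrightarrow> 0"
    using closed Fn Kn L by (intro weak_conv_imp_levy_dist) (auto simp: neutral_left)
  moreover have "(\<lambda>n. levy_dist ((Kn \<circ> s) n) L) \<longlonglongrightarrow> 0"
    using Kn L weak by (intro weak_conv_imp_levy_dist) (auto simp: comp_def)
  ultimately have "(\<lambda>n. levy_dist (star ((Fn \<circ> s) n) ((Kn \<circ> s) n)) L + levy_dist ((Kn \<circ> s) n) L) \<longlonglongrightarrow> 0 + 0"
    by (rule tendsto_add)
  then have "eventually (\<lambda>n. levy_dist (star ((Fn \<circ> s) n) ((Kn \<circ> s) n)) L + levy_dist ((Kn \<circ> s) n) L < e) sequentially"
    using e by (intro order_tendstoD) auto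
  then obtain n where "levy_dist (star (Fn (s n)) (Kn (s n))) L + levy_dist (Kn (s n)) L < e"
    by (auto simp: eventually_sequentially)
  moreover have "levy_dist (star (Fn (s n)) (Kn (s n))) (Kn (s n))
      \<le> levy_dist (star (Fn (s n)) (Kn (s n))) L + levy_dist (Kn (s n)) L"
    using levy_dist_triangle[of "star (Fn (s n)) (Kn (s n))" L "Kn (s n)"] closed Fn Kn L
      levy_dist_sym[of L] by auto
  ultimately show False
    using large[of "s n"] by linarith
qed

section \<open>The metric\<close>

context prob_metric_space
begin

lemma bdd_above_levy_dist_D:
  "x \<in> G \<Longrightarrow> y \<in> G \<Longrightarrow> bdd_above ((\<lambda>z. levy_dist (D x z) (D y z)) ` G)"
  using levy_dist_bounds(2)[OF D_in D_in] by (auto intro!: bdd_aboveI[of _ 1])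

lemma levy_dist_D_le_sigma:
  "x \<in> G \<Longrightarrow> y \<in> G \<Longrightarrow> z \<in> G \<Longrightarrow> levy_dist (D x z) (D y z) \<le> sigma_dist G D x y"
  using bdd_above_levy_dist_D by (auto simp: sigma_dist_def intro!: cSUP_upper)

lemma levy_dist_Heav_le_sigma:
  assumes "x \<in> G" "y \<in> G"
  shows "levy_dist (D x y) (Heav 0) \<le> sigma_dist G D x y"
proof -
  have "D y y = Heav 0"
    using assms D_eq_Heav by blast
  then show ?thesis
    using levy_dist_D_le_sigma[OF assms assms(2)] by simp
qed

lemma sigma_nonneg: "0 \<le> sigma_dist G D x y"
proof (cases "x \<in> G \<and> y \<in> G")
  case True
  then show ?thesis
    using levy_dist_bounds(1)[OF D_in Heav_0_in_Delta_plus] levy_dist_Heav_le_sigma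
    by (meson order_trans)
qed (auto simp: sigma_dist_def)

text \<open>Separation comes from the lower bound by the distance to \<open>Heav 0\<close>; symmetry
  and the triangle inequality hold for each term of the supremum.\<close>

lemma Metric_space_sigma: "Metric_space G (sigma_dist G D)"
proof
  show "0 \<le> sigma_dist G D x y" for x y
    by (rule sigma_nonneg)
  show "sigma_dist G D x y = sigma_dist G D y x" for x y
    by (simp add: sigma_dist_def levy_dist_sym)
  show "sigma_dist G D x y = 0 \<longleftrightarrow> x = y" if "x \<in> G" "y \<in> G" for x y
  proof
    assume "sigma_dist G D x y = 0"
    then have "levy_dist (D x y) (Heav 0) = 0"
      using levy_dist_Heav_le_sigma[OF that] levy_dist_bounds(1)[OF D_in[OF that] Heav_0_in_Delta_plus]
      by simp
    then have "D x y = Heav 0"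
      using levy_dist_Heav_eq_0_imp D_in that by blast
    then show "x = y"
      using D_eq_Heav that by blast
  next
    assume "x = y"
    with that have "sigma_dist G D x y = (SUP z\<in>G. 0)"
      by (simp add: sigma_dist_def levy_dist_self D_in)
    also have "\<dots> = 0"
      using that by (intro cSUP_const) auto
    finally show "sigma_dist G D x y = 0" .
  qed
  show "sigma_dist G D x z \<le> sigma_dist G D x y + sigma_dist G D y z"
    if "x \<in> G" "y \<in> G" "z \<in> G" for x y z
  proof -
    have "levy_dist (D x w) (D z w) \<le> sigma_dist G D x y + sigma_dist G D y z" if w: "w \<in> G" for w
      using levy_dist_triangle[of "D x w" "D y w" "D z w"]
        levy_dist_D_le_sigma[of x y w] levy_dist_D_le_sigma[of y z w] D_in w
        \<open>x \<in> G\<close> \<open>y \<in> G\<close> \<open>z \<in> G\<close> by fastforce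
    then have "(SUP w\<in>G. levy_dist (D x w) (D z w)) \<le> sigma_dist G D x y + sigma_dist G D y z"
      using that by (intro cSUP_least) auto
    then show ?thesis
      using that by (simp add: sigma_dist_def[of G D x z])
  qed
qed

section \<open>Upper bounds for the metric\<close>

text \<open>Common core of the upper bounds: \<open>c\<close> will be the modulus value, the
  Lipschitz bound, or \<open>e / 2\<close> in the continuity argument.\<close>

lemma sigma_le:
  assumes x: "x \<in> G" and y: "y \<in> G"
    and bound: "\<And>L. L \<in> Delta_plus \<Longrightarrow> levy_dist (star (D x y) L) L \<le> c"
  shows "sigma_dist G D x y \<le> c"
proof -
  have "levy_dist (D x z) (D y z) \<le> c" if z: "z \<in> G" for z
  proof (rule field_le_epsilon)
    fix e :: real
    assume e: "0 < e"
    have D: "D x y \<in> Delta_plus" "D y z \<in> Delta_plus" "D x z \<in> Delta_plus"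
      using D_in x y z by auto
    have 1: "levy_valid (c + e) (star (D x y) (D y z)) (D y z)"
      using bound[OF D(2)] e D closed by (intro levy_valid_if_levy_dist_less) auto
    have 2: "levy_valid (c + e) (star (D x y) (D x z)) (D x z)"
      using bound[OF D(3)] e D closed by (intro levy_valid_if_levy_dist_less) auto
    have 3: "df_le (star (D x y) (D y z)) (D x z)" "df_le (star (D x y) (D x z)) (D y z)"
      using D_triangle[of x y z] D_triangle[of y x z] D_sym[of x y] x y z by auto
    \<comment> \<open>Each of the two valid comparisons supplies one direction: its product is
      evaluated at \<open>t + (c + e)\<close> and replaced there by the larger function from the
      triangle inequality.\<close>
    have "levy_valid (c + e) (D x z) (D y z)"
      using 1 2 3 unfolding levy_valid_def df_le_def by (meson add_right_mono order_trans)
    then show "levy_dist (D x z) (D y z) \<le> c + e"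
      by (rule levy_dist_le)
  qed
  then have "(SUP z\<in>G. levy_dist (D x z) (D y z)) \<le> c"
    using x by (intro cSUP_least) auto
  then show ?thesis
    using x y by (simp add: sigma_dist_def)
qed

lemma sigma_le_modulus:
  assumes x: "x \<in> G" and y: "y \<in> G" and "modulus_tf \<omega> star"
  shows "ennreal (sigma_dist G D x y) \<le> \<omega> (ennreal (levy_dist (D x y) (Heav 0)))"
\<comment> \<open>An infinite modulus value makes the claim trivial; a finite one serves as the real
  bound \<open>c\<close>.\<close>
proof (cases "\<omega> (ennreal (levy_dist (D x y) (Heav 0)))")
  case (real r)
  have "levy_dist (star (D x y) L) L \<le> r" if L: "L \<in> Delta_plus" for L
  proof -
    have "ennreal (levy_dist (star (D x y) L) (star (Heav 0) L))
        \<le> \<omega> (ennreal (levy_dist (D x y) (Heav 0) + levy_dist L L))"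
      using assms L D_in Heav_0_in_Delta_plus by (simp add: modulus_tf_def)
    then show ?thesis
      using L real by (simp add: levy_dist_self neutral_left)
  qed
  then have "sigma_dist G D x y \<le> r"
    using sigma_le x y by blast
  then show ?thesis
    using real by (simp add: ennreal_leI)
qed simp

lemma sigma_le_lipschitz:
  assumes x: "x \<in> G" and y: "y \<in> G" and lip: "lipschitz_tf k star"
  shows "sigma_dist G D x y \<le> k * levy_dist (D x y) (Heav 0)"
proof (rule sigma_le[OF x y])
  fix L
  assume L: "L \<in> Delta_plus"
  have "levy_dist (star (D x y) L) (star (Heav 0) L)
      \<le> k * (levy_dist (D x y) (Heav 0) + levy_dist L L)"
    using lip L D_in[OF x y] Heav_0_in_Delta_plus by (simp add: lipschitz_tf_def)
  then show "levy_dist (star (D x y) L) L \<le> k * levy_dist (D x y) (Heav 0)"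
    using L by (simp add: levy_dist_self neutral_left)
qed

lemma sigma_small:
  assumes "continuous_tf star" "0 < e"
  obtains d where "0 < d"
    "\<And>x y. x \<in> G \<Longrightarrow> y \<in> G \<Longrightarrow> levy_dist (D x y) (Heav 0) < d \<Longrightarrow> sigma_dist G D x y < e"
proof -
  obtain d where d: "0 < d" "\<And>F L. F \<in> Delta_plus \<Longrightarrow> L \<in> Delta_plus \<Longrightarrow>
      levy_dist F (Heav 0) < d \<Longrightarrow> levy_dist (star F L) L < e / 2"
    using continuous_imp_levy_dist_star_small[OF assms(1), of "e / 2"] assms(2) by auto
  have "sigma_dist G D x y \<le> e / 2" if "x \<in> G" "y \<in> G" "levy_dist (D x y) (Heav 0) < d" for x y
    using that d(2) D_in by (intro sigma_le) (auto intro: less_imp_le)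
  with d(1) assms(2) show ?thesis
    by (intro that[of d]) force+
qed

section \<open>Comparison of topologies and uniformities\<close>

lemma strong_nhd_eq:
  "x \<in> G \<Longrightarrow> 0 < t \<Longrightarrow> strong_nhd G D x t = {y \<in> G. levy_dist (D x y) (Heav 0) < t}"
  using levy_dist_Heav_less_iff D_in by (auto simp: strong_nhd_def)

text \<open>The hypothesis is what the continuous and the Lipschitz case share. Together with the
  lower bound it makes both topologies and both filters equal, so the identity works in either
  direction.\<close>

lemma uniform_homeomorphism_sigma:
  assumes small: "\<And>e. 0 < e \<Longrightarrow> \<exists>d>0. \<forall>x\<in>G. \<forall>y\<in>G.
    levy_dist (D x y) (Heav 0) < d \<longrightarrow> sigma_dist G D x y < e"
  shows "uniform_homeomorphism_maps
    (strong_topology G D) (strong_uniformity G D)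
    (Metric_space.mtopology G (sigma_dist G D)) (metric_uniformity G (sigma_dist G D)) id id"
proof -
  interpret S: Metric_space G "sigma_dist G D"
    by (rule Metric_space_sigma)
  have "openin (strong_topology G D) U \<longleftrightarrow> openin S.mtopology U" for U
  proof -
    \<comment> \<open>The two neighborhood bases interleave: a ball lies in the strong neighborhood
      of the same radius by the lower bound, and \<open>small\<close> gives the converse with a
      smaller radius.\<close>
    have "(\<exists>t>0. strong_nhd G D x t \<subseteq> U) \<longleftrightarrow> (\<exists>r>0. S.mball x r \<subseteq> U)" if x: "x \<in> G" for x
    proof
      assume "\<exists>t>0. strong_nhd G D x t \<subseteq> U"
      then obtain t where t: "0 < t" "strong_nhd G D x t \<subseteq> U"
        by blast
      then have "S.mball x t \<subseteq> U"
        using x levy_dist_Heav_le_sigma[OF x] by (fastforce simp: strong_nhd_eq S.mball_def)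
      then show "\<exists>r>0. S.mball x r \<subseteq> U"
        using t(1) by blast
    next
      assume "\<exists>r>0. S.mball x r \<subseteq> U"
      then obtain r where r: "0 < r" "S.mball x r \<subseteq> U"
        by blast
      obtain d where d: "0 < d" "\<forall>x\<in>G. \<forall>y\<in>G. levy_dist (D x y) (Heav 0) < d \<longrightarrow> sigma_dist G D x y < r"
        using small[OF r(1)] by blast
      then have "strong_nhd G D x d \<subseteq> U"
        using x r(2) by (auto simp: strong_nhd_eq S.mball_def)
      then show "\<exists>t>0. strong_nhd G D x t \<subseteq> U"
        using d(1) by blast
    qed
    then show ?thesis
      unfolding openin_strong_topology S.openin_mtopology by blast
  qed
  then have top: "strong_topology G D = S.mtopology"
    by (simp add: topology_eq)
  have "strong_uniformity G D = metric_uniformity G (sigma_dist G D)"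
  proof (rule antisym)
    show "strong_uniformity G D \<le> metric_uniformity G (sigma_dist G D)"
      unfolding metric_uniformity_def
    proof (rule INF_greatest)
      fix e :: real
      assume "e \<in> {0<..}"
      then obtain d where "0 < d"
        "\<forall>x\<in>G. \<forall>y\<in>G. levy_dist (D x y) (Heav 0) < d \<longrightarrow> sigma_dist G D x y < e"
        using small[of e] by auto
      then show "strong_uniformity G D \<le> principal {(x, y). x \<in> G \<and> y \<in> G \<and> sigma_dist G D x y < e}"
        unfolding strong_uniformity_def by (intro INF_lower2[of d]) auto
    qed
    show "metric_uniformity G (sigma_dist G D) \<le> strong_uniformity G D"
      unfolding metric_uniformity_def strong_uniformity_def
      using levy_dist_Heav_le_sigma by (intro INF_mono) (force simp: case_prod_unfold)
  qed
  then show ?thesis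
    using top by (simp add: uniform_homeomorphism_maps_def uniformly_cont_def homeomorphic_maps_def
        filterlim_ident case_prod_unfold)
qed

end

theorem theorem1:
  fixes G :: "'a set" and D :: "'a \<Rightarrow> 'a \<Rightarrow> ereal \<Rightarrow> real"
    and star :: "(ereal \<Rightarrow> real) \<Rightarrow> (ereal \<Rightarrow> real) \<Rightarrow> (ereal \<Rightarrow> real)"
  assumes "prob_metric_space G D star"
  shows
    "(continuous_tf star \<longrightarrow>
        Metric_space G (sigma_dist G D) \<and>
        (\<forall>x\<in>G. \<forall>y\<in>G.
           levy_dist (D x y) (Heav 0) \<le> sigma_dist G D x y \<and>
           (\<forall>\<omega>. modulus_tf \<omega> star \<longrightarrow>
              ennreal (sigma_dist G D x y) \<le> \<omega> (ennreal (levy_dist (D x y) (Heav 0))))) \<and>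
        uniform_homeomorphism_maps
          (strong_topology G D) (strong_uniformity G D)
          (Metric_space.mtopology G (sigma_dist G D)) (metric_uniformity G (sigma_dist G D))
          id id)
     \<and>
     (\<forall>k>0. lipschitz_tf k star \<longrightarrow>
        Metric_space G (sigma_dist G D) \<and>
        (\<forall>x\<in>G. \<forall>y\<in>G.
           levy_dist (D x y) (Heav 0) \<le> sigma_dist G D x y \<and>
           sigma_dist G D x y \<le> k * levy_dist (D x y) (Heav 0)) \<and>
        uniform_homeomorphism_maps
          (strong_topology G D) (strong_uniformity G D)
          (Metric_space.mtopology G (sigma_dist G D)) (metric_uniformity G (sigma_dist G D))
          id id)"
proof -
  interpret prob_metric_space G D star
    by (rule assms)
  show ?thesis
  proof (intro conjI impI allI ballI)
    assume cont: "continuous_tf star"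
    show "uniform_homeomorphism_maps
        (strong_topology G D) (strong_uniformity G D)
        (Metric_space.mtopology G (sigma_dist G D)) (metric_uniformity G (sigma_dist G D)) id id"
      using sigma_small[OF cont] by (intro uniform_homeomorphism_sigma) metis
  next
    fix k :: real
    assume k: "0 < k" and lip: "lipschitz_tf k star"
    show "uniform_homeomorphism_maps
        (strong_topology G D) (strong_uniformity G D)
        (Metric_space.mtopology G (sigma_dist G D)) (metric_uniformity G (sigma_dist G D)) id id"
    proof (rule uniform_homeomorphism_sigma)
      fix e :: real
      assume "0 < e"
      then show "\<exists>d>0. \<forall>x\<in>G. \<forall>y\<in>G. levy_dist (D x y) (Heav 0) < d \<longrightarrow> sigma_dist G D x y < e"
        using k sigma_le_lipschitz[OF _ _ lip]
        \<comment> \<open>With \<open>d = e / k\<close>, the Lipschitz bound gives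
          \<open>k * levy_dist (D x y) (Heav 0) < e\<close>.\<close>
        by (intro exI[of _ "e / k"]) (force simp: field_simps)
    qed
  qed (simp_all add: Metric_space_sigma levy_dist_Heav_le_sigma sigma_le_modulus sigma_le_lipschitz)
qed

end
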